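(* Let $(W,S)$ be a Coxeter system, with $W$ partially ordered by the Bruhat order $\leq_{\mathsf B}$. Let $F\in\mathrm{Mac}(W)$ and $u\in W$. Then $\nabla(\pi_u(F))\in\mathrm{Mac}(W)$. Moreover, for every subset $Y\subseteq W$, we have $\nabla(\pi_u(\nabla(Y)))=\nabla(\pi_u(Y))$.
   Context: For a poset $P$ and $X\subseteq P$, let $\mathrm{U}(X)=\{p\in P: p\geq x\text{ for all }x\in X\}$ and $\mathrm{L}(X)=\{p\in P: p\leq x\text{ for all }x\in X\}$. An order filter of $P$ is a subset $F$ with $x\le y$, $x\in F\Rightarrow y\in F$. The MacNeille completion $\mathrm{Mac}(P)$ is the set of order filters $F$ of $P$ with $F=\mathrm{U}(\mathrm{L}(F))$. For $w\in W$, $\ell(w)$ is the Coxeter length and $\mathrm{Des}(w)=\{s\in S:\ell(sw)<\ell(w)\}$ is the set of left descents. For $s\in S$, define $\pi_s\colon W\to W$ by $\pi_s(w)=sw$ if $s\in\mathrm{Des}(w)$ and $\pi_s(w)=w$ otherwise. For $u\in W$, let $\pi_u=\pi_{s_1}\cdots\pi_{s_k}$ where $s_1\cdots s_k$ is any reduced word for $u$ (this is well defined; $\pi_e$ is the identity). For $X\subseteq W$, $\pi_u(X)=\{\pi_u(x):x\in X\}$ and $\nabla(X)=\{w\in W: x\leq_{\mathsf B} w\text{ for some }x\in X\}$. Here $\mathrm{Mac}(W)$ is taken with respect to the Bruhat order. *)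

theory Defs
  imports "HOL-Algebra.Generated_Groups" "HOL-Algebra.Order"
begin

definition order_filter :: "('a, 'b) gorder_scheme \<Rightarrow> 'a set \<Rightarrow> bool" where
  "order_filter P F \<longleftrightarrow> F \<subseteq> carrier P \<and>
     (\<forall>x\<in>F. \<forall>y\<in>carrier P. x \<sqsubseteq>\<^bsub>P\<^esub> y \<longrightarrow> y \<in> F)"

definition Mac :: "('a, 'b) gorder_scheme \<Rightarrow> 'a set set" where
  "Mac P = {F. order_filter P F \<and> F = Upper P (Lower P F)}"

definition nabla :: "('a, 'b) gorder_scheme \<Rightarrow> 'a set \<Rightarrow> 'a set" where
  "nabla P X = {w \<in> carrier P. \<exists>x\<in>X. x \<sqsubseteq>\<^bsub>P\<^esub> w}"

text \<open>The value \<open>m s t = 0\<close> encodes \<open>m(s,t) = \<infinity>\<close>.\<close>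

definition coxeter_matrix :: "'a set \<Rightarrow> ('a \<Rightarrow> 'a \<Rightarrow> nat) \<Rightarrow> bool" where
  "coxeter_matrix S m \<longleftrightarrow>
     (\<forall>s\<in>S. m s s = 1) \<and>
     (\<forall>s\<in>S. \<forall>t\<in>S. s \<noteq> t \<longrightarrow> m s t = m t s \<and> m s t \<noteq> 1)"

text \<open>Insertion of a single relator \<open>(s t)\<^bsup>m(s,t)\<^esup>\<close> into a word over \<open>S\<close>. If \<open>m(s,t) = \<infinity>\<close>
  the relator is the empty word, so no relation is imposed.\<close>

definition insert_relator ::
    "'a set \<Rightarrow> ('a \<Rightarrow> 'a \<Rightarrow> nat) \<Rightarrow> 'a list \<Rightarrow> 'a list \<Rightarrow> bool" where
  "insert_relator S m xs ys \<longleftrightarrow>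
     (\<exists>us\<in>lists S. \<exists>vs\<in>lists S. \<exists>s\<in>S. \<exists>t\<in>S.
        xs = us @ vs \<and> ys = us @ concat (replicate (m s t) [s, t]) @ vs)"

definition word_prod :: "('a, 'b) monoid_scheme \<Rightarrow> 'a list \<Rightarrow> 'a" where
  "word_prod W xs = foldr (mult W) xs (one W)"

text \<open>\<open>W\<close> has the presentation with generators \<open>S\<close> and relations \<open>(s t)\<^bsup>m(s,t)\<^esup> = 1\<close>.
  Words in \<open>S\<close> without formal inverses suffice, because the relators \<open>s s\<close> (from \<open>m(s,s) = 1\<close>)
  make each generator its own inverse. No finiteness of \<open>S\<close> is assumed.\<close>

locale coxeter_system = group W for W (structure) +
  fixes S
  assumes generators_closed: "S \<subseteq> carrier W"
    and generators_generate: "generate W S = carrier W"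
    and presentation:
      "\<exists>m. coxeter_matrix S m \<and>
         (\<forall>xs\<in>lists S. \<forall>ys\<in>lists S.
            word_prod W xs = word_prod W ys \<longleftrightarrow> equivclp (insert_relator S m) xs ys)"

definition cox_length :: "('a, 'b) monoid_scheme \<Rightarrow> 'a set \<Rightarrow> 'a \<Rightarrow> nat" where
  "cox_length W S w = (LEAST n. \<exists>xs\<in>lists S. length xs = n \<and> word_prod W xs = w)"

definition reduced_word :: "('a, 'b) monoid_scheme \<Rightarrow> 'a set \<Rightarrow> 'a \<Rightarrow> 'a list \<Rightarrow> bool" where
  "reduced_word W S w xs \<longleftrightarrow>
     xs \<in> lists S \<and> word_prod W xs = w \<and> length xs = cox_length W S w"

definition reflections :: "('a, 'b) monoid_scheme \<Rightarrow> 'a set \<Rightarrow> 'a set" where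
  "reflections W S = {w \<otimes>\<^bsub>W\<^esub> s \<otimes>\<^bsub>W\<^esub> inv\<^bsub>W\<^esub> w | w s. w \<in> carrier W \<and> s \<in> S}"

definition bruhat_step :: "('a, 'b) monoid_scheme \<Rightarrow> 'a set \<Rightarrow> 'a \<Rightarrow> 'a \<Rightarrow> bool" where
  "bruhat_step W S u v \<longleftrightarrow> u \<in> carrier W \<and>
     (\<exists>t\<in>reflections W S. v = u \<otimes>\<^bsub>W\<^esub> t) \<and> cox_length W S u < cox_length W S v"

definition bruhat :: "('a, 'b) monoid_scheme \<Rightarrow> 'a set \<Rightarrow> 'a gorder" where
  "bruhat W S = \<lparr>carrier = carrier W, eq = (=), le = (bruhat_step W S)\<^sup>*\<^sup>*\<rparr>"

definition Des :: "('a, 'b) monoid_scheme \<Rightarrow> 'a set \<Rightarrow> 'a \<Rightarrow> 'a set" where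
  "Des W S w = {s \<in> S. cox_length W S (s \<otimes>\<^bsub>W\<^esub> w) < cox_length W S w}"

definition pi_gen :: "('a, 'b) monoid_scheme \<Rightarrow> 'a set \<Rightarrow> 'a \<Rightarrow> 'a \<Rightarrow> 'a" where
  "pi_gen W S s w = (if s \<in> Des W S w then s \<otimes>\<^bsub>W\<^esub> w else w)"

text \<open>\<open>\<pi>\<^sub>u = \<pi>\<^bsub>s\<^sub>1\<^esub> \<circ> \<dots> \<circ> \<pi>\<^bsub>s\<^sub>k\<^esub>\<close> for a reduced word \<open>s\<^sub>1 \<dots> s\<^sub>k\<close> of \<open>u\<close>. The operators \<open>\<pi>\<^sub>s\<close> satisfy the
  braid relations, so the result does not depend on which reduced word is chosen.\<close>

definition pi_elt :: "('a, 'b) monoid_scheme \<Rightarrow> 'a set \<Rightarrow> 'a \<Rightarrow> 'a \<Rightarrow> 'a" where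
  "pi_elt W S u = foldr (pi_gen W S) (SOME ss. reduced_word W S u ss)"

end

theory Submission
  imports Defs
begin

text \<open>For a simple reflection \<open>s\<close>, the map \<open>\<pi>\<^sub>s w = min(w, s w)\<close> is the lower adjoint of
  \<open>\<tau>\<^sub>s w = max(w, s w)\<close> in the Bruhat order. Hence \<open>\<nabla>(\<pi>\<^sub>s F) = {y. \<tau>\<^sub>s y \<in> F}\<close>, and for
  \<open>F = U(L(F))\<close> this set is \<open>U(\<pi>\<^sub>s(L(F)))\<close>, which belongs to the MacNeille completion. The case
  of \<open>\<pi>\<^sub>u\<close> follows by induction along a reduced word.

  The adjunction holds as soon as \<open>\<pi>\<^sub>s\<close> and \<open>\<tau>\<^sub>s\<close> are monotone, and for this it suffices that
  \<open>\<ell>(u) < \<ell>(t u)\<close> implies \<open>\<ell>(s u) < \<ell>(s t u)\<close> for every reflection \<open>t \<noteq> s\<close>. For a word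
  \<open>s\<^sub>1 \<dots> s\<^sub>k\<close> consider the parity of the number of \<open>i\<close> with
  \<open>t = s\<^sub>1 \<dots> s\<^sub>i \<dots> s\<^sub>1\<close>. It is a cocycle, it is invariant under insertion of relators, and it
  is odd precisely when \<open>\<ell>(t w) < \<ell>(w)\<close>; the implication is the cocycle identity for \<open>s\<close>
  and \<open>u\<close>.\<close>

section \<open>Adjunctions and the MacNeille completion\<close>

context weak_partial_order
begin

text \<open>The maps U and L form an antitone Galois connection, so U L U = U.\<close>

lemma Upper_in_Mac:
  assumes "A \<subseteq> carrier L"
  shows "Upper L A \<in> Mac L"
proof -
  have "Upper L A \<subseteq> Upper L (Lower L (Upper L A))"
    by (auto simp: Upper_def Lower_def)
  moreover have "A \<subseteq> Lower L (Upper L A)"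
    using assms by (auto simp: Upper_def Lower_def)
  then have "Upper L (Lower L (Upper L A)) \<subseteq> Upper L A"
    by (rule Upper_antimono)
  moreover have "order_filter L (Upper L A)"
    unfolding order_filter_def
  proof (intro conjI ballI impI)
    show "Upper L A \<subseteq> carrier L" by (rule Upper_closed)
  next
    fix x y assume "x \<in> Upper L A" "y \<in> carrier L" "x \<sqsubseteq> y"
    then show "y \<in> Upper L A"
      using assms by (auto simp: Upper_def intro: le_trans)
  qed
  ultimately show ?thesis
    unfolding Mac_def by blast
qed

lemma nabla_lower_adjoint_in_Mac:
  assumes f: "f \<in> carrier L \<rightarrow> carrier L" and g: "g \<in> carrier L \<rightarrow> carrier L"
    and adj: "\<And>x y. x \<in> carrier L \<Longrightarrow> y \<in> carrier L \<Longrightarrow> f x \<sqsubseteq> y \<longleftrightarrow> x \<sqsubseteq> g y"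
    and F: "F \<in> Mac L"
  shows "nabla L (f ` F) \<in> Mac L"
proof -
  have Fc: "F \<subseteq> carrier L" and up: "\<And>x y. x \<in> F \<Longrightarrow> y \<in> carrier L \<Longrightarrow> x \<sqsubseteq> y \<Longrightarrow> y \<in> F"
    and FU: "F = Upper L (Lower L F)"
    using F by (auto simp: Mac_def order_filter_def)
  have "nabla L (f ` F) = {y \<in> carrier L. g y \<in> F}"
  proof (intro equalityI subsetI)
    fix y assume "y \<in> nabla L (f ` F)"
    then obtain x where "y \<in> carrier L" "x \<in> F" "f x \<sqsubseteq> y"
      by (auto simp: nabla_def)
    then show "y \<in> {y \<in> carrier L. g y \<in> F}"
      using adj[of x y] up[of x "g y"] funcset_mem[OF g, of y] Fc by auto
  next
    fix y assume "y \<in> {y \<in> carrier L. g y \<in> F}"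
    \<comment> \<open>The witness is \<open>g y\<close>, since \<open>f (g y)\<close> lies below
      \<open>y\<close> by the adjunction.\<close>
    then show "y \<in> nabla L (f ` F)"
      using adj[of "g y" y] funcset_mem[OF g, of y] by (auto simp: nabla_def)
  qed
  \<comment> \<open>As F = U(L(F)), membership of \<open>g y\<close> in \<open>F\<close> means that
    every lower bound \<open>l\<close> of \<open>F\<close> is below \<open>g y\<close>; the
    adjunction turns this into \<open>f l\<close> being below \<open>y\<close>.\<close>
  also have "\<dots> = Upper L (f ` Lower L F)"
  proof (intro equalityI subsetI)
    fix y assume y: "y \<in> {y \<in> carrier L. g y \<in> F}"
    then have "l \<sqsubseteq> g y" if "l \<in> Lower L F" for l
      using that g by (auto simp: Lower_def)
    then show "y \<in> Upper L (f ` Lower L F)"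
      using y adj by (auto simp: Upper_def Lower_def)
  next
    fix y assume y: "y \<in> Upper L (f ` Lower L F)"
    then have yc: "y \<in> carrier L" by (simp add: Upper_def)
    have "l \<sqsubseteq> g y" if "l \<in> Lower L F" for l
    proof -
      have l: "l \<in> carrier L" using that by (simp add: Lower_def)
      then have "f l \<sqsubseteq> y" using y f that by (auto simp: Upper_def)
      then show ?thesis using adj l yc by simp
    qed
    then have "g y \<in> Upper L (Lower L F)"
      using g yc by (auto simp: Upper_def)
    then show "y \<in> {y \<in> carrier L. g y \<in> F}"
      using FU yc by simp
  qed
  finally have "nabla L (f ` F) = Upper L (f ` Lower L F)" .
  moreover have "f ` Lower L F \<subseteq> carrier L"
    using f by (auto simp: Lower_def)
  ultimately show ?thesis by (simp add: Upper_in_Mac)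
qed

text \<open>Every element of \<open>nabla L Y\<close> lies above some \<open>y\<close> in
  \<open>Y\<close>, and monotonicity carries this to the images; the other inclusion is
  reflexivity.\<close>

lemma nabla_image_nabla:
  assumes f: "f \<in> carrier L \<rightarrow> carrier L"
    and mono: "\<And>x y. x \<in> carrier L \<Longrightarrow> y \<in> carrier L \<Longrightarrow> x \<sqsubseteq> y \<Longrightarrow> f x \<sqsubseteq> f y"
    and Y: "Y \<subseteq> carrier L"
  shows "nabla L (f ` nabla L Y) = nabla L (f ` Y)"
proof (intro equalityI subsetI)
  fix w assume "w \<in> nabla L (f ` nabla L Y)"
  then obtain x y where w: "w \<in> carrier L" "f x \<sqsubseteq> w" and xy: "x \<in> carrier L" "y \<in> Y" "y \<sqsubseteq> x"
    by (auto simp: nabla_def)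
  then have "f y \<sqsubseteq> f x" using mono Y by blast
  then have "f y \<sqsubseteq> w"
    using w xy Y funcset_mem[OF f, of x] funcset_mem[OF f, of y] le_trans[of "f y" "f x" w]
    by auto
  then show "w \<in> nabla L (f ` Y)" using w xy by (auto simp: nabla_def)
next
  fix w assume "w \<in> nabla L (f ` Y)"
  moreover have "Y \<subseteq> nabla L Y" using Y by (fastforce simp: nabla_def)
  ultimately show "w \<in> nabla L (f ` nabla L Y)" unfolding nabla_def by blast
qed

end

section \<open>The parity cocycle of a Coxeter system\<close>

context monoid
begin

lemma word_prod_Nil [simp]: "word_prod G [] = \<one>"
  by (simp add: word_prod_def)

lemma word_prod_Cons [simp]: "word_prod G (x # xs) = x \<otimes> word_prod G xs"
  by (simp add: word_prod_def)

lemma word_prod_closed [simp]: "xs \<in> lists (carrier G) \<Longrightarrow> word_prod G xs \<in> carrier G"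
  by (induction xs) auto

lemma word_prod_append:
  "\<lbrakk>xs \<in> lists (carrier G); ys \<in> lists (carrier G)\<rbrakk>
    \<Longrightarrow> word_prod G (xs @ ys) = word_prod G xs \<otimes> word_prod G ys"
  by (induction xs) (auto simp: m_assoc)

lemma word_prod_relator:
  assumes "x \<in> carrier G" "y \<in> carrier G"
  shows "word_prod G (concat (replicate k [x, y])) = (x \<otimes> y) [^] k"
proof (induction k)
  case (Suc k)
  have "(x \<otimes> y) [^] Suc k = x \<otimes> y \<otimes> (x \<otimes> y) [^] k"
    using assms by (intro nat_pow_Suc2) auto
  with Suc show ?case
    using assms by (simp only: replicate_Suc concat.simps append.simps word_prod_Cons)
      (simp add: m_assoc)
qed simp

end

context group
begin

lemma mult_inv_cancel:
  assumes "g \<in> carrier G" "x \<in> carrier G"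
  shows "g \<otimes> (inv g \<otimes> x) = x" "inv g \<otimes> (g \<otimes> x) = x"
  using assms by (simp_all flip: m_assoc)

lemma conj_eq_iff:
  assumes "g \<in> carrier G" "x \<in> carrier G" "y \<in> carrier G"
  shows "inv g \<otimes> x \<otimes> g = y \<longleftrightarrow> x = g \<otimes> y \<otimes> inv g"
proof
  assume "inv g \<otimes> x \<otimes> g = y"
  then show "x = g \<otimes> y \<otimes> inv g"
    using assms by (auto simp: m_assoc mult_inv_cancel)
next
  assume "x = g \<otimes> y \<otimes> inv g"
  then show "inv g \<otimes> x \<otimes> g = y"
    using assms by (simp add: m_assoc mult_inv_cancel)
qed

end

context coxeter_system
begin

section \<open>Consequences of the presentation\<close>

lemma lists_generators_closed: "xs \<in> lists S \<Longrightarrow> xs \<in> lists (carrier W)"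
  using generators_closed by auto

definition coxeter_presentation :: "('a \<Rightarrow> 'a \<Rightarrow> nat) \<Rightarrow> bool" where
  "coxeter_presentation m \<longleftrightarrow> coxeter_matrix S m \<and>
     (\<forall>xs\<in>lists S. \<forall>ys\<in>lists S.
        word_prod W xs = word_prod W ys \<longleftrightarrow> equivclp (insert_relator S m) xs ys)"

text \<open>Insert the relator into the empty word. If \<open>m s t = 0\<close>, the claim is about
  the zeroth power.\<close>

lemma relator_eq_one:
  assumes m: "coxeter_presentation m" and st: "s \<in> S" "t \<in> S"
  shows "(s \<otimes> t) [^] m s t = \<one>"
proof -
  let ?r = "concat (replicate (m s t) [s, t])"
  have "insert_relator S m [] ?r"
    unfolding insert_relator_def using st
    by (intro bexI[of _ "[]"] bexI[of _ s] bexI[of _ t]) auto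
  then have "equivclp (insert_relator S m) [] ?r" by blast
  moreover have "?r \<in> lists S" using st by (induction "m s t") auto
  ultimately have "word_prod W [] = word_prod W ?r"
    using m unfolding coxeter_presentation_def by blast
  then show ?thesis using st generators_closed by (simp add: word_prod_relator subset_iff)
qed

lemma obtain_presentation:
  obtains m where "coxeter_presentation m"
  using presentation by (auto simp: coxeter_presentation_def)

lemma generator_square:
  assumes "s \<in> S"
  shows "s \<otimes> s = \<one>"
proof -
  obtain m where m: "coxeter_presentation m" by (rule obtain_presentation)
  then have "m s s = 1" using assms by (simp add: coxeter_presentation_def coxeter_matrix_def)
  then show ?thesis using relator_eq_one[OF m assms assms] assms generators_closed by auto
qed

lemma generator_inv: "s \<in> S \<Longrightarrow> inv s = s"
  using generator_square generators_closed by (intro inv_equality) auto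

text \<open>Generators are involutions, so the inverses allowed by \<open>generate\<close> are again
  single letters.\<close>

lemma obtain_word:
  assumes "w \<in> carrier W"
  obtains xs where "xs \<in> lists S" "word_prod W xs = w"
proof -
  have "w \<in> generate W S" using assms generators_generate by simp
  then have "\<exists>xs\<in>lists S. word_prod W xs = w"
  proof (induction rule: generate.induct)
    case one
    then show ?case by (intro bexI[of _ "[]"]) auto
  next
    case (incl s)
    then show ?case using generators_closed by (intro bexI[of _ "[s]"]) auto
  next
    case (inv s)
    then show ?case using generators_closed
      by (intro bexI[of _ "[s]"]) (auto simp: generator_inv)
  next
    case (eng h1 h2)
    then obtain xs ys where "xs \<in> lists S" "ys \<in> lists S"
      "word_prod W xs = h1" "word_prod W ys = h2" by blast
    then show ?case
      by (intro bexI[of _ "xs @ ys"]) (auto simp: word_prod_append lists_generators_closed)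
  qed
  then show thesis using that by blast
qed

lemma obtain_reduced_word:
  assumes "w \<in> carrier W"
  obtains xs where "reduced_word W S w xs"
proof -
  have "\<exists>n. \<exists>xs\<in>lists S. length xs = n \<and> word_prod W xs = w"
    using assms by (metis obtain_word)
  then have "\<exists>xs\<in>lists S. length xs = cox_length W S w \<and> word_prod W xs = w"
    unfolding cox_length_def by (rule LeastI_ex)
  then show thesis using that by (auto simp: reduced_word_def)
qed

lemma cox_length_le: "xs \<in> lists S \<Longrightarrow> cox_length W S (word_prod W xs) \<le> length xs"
  unfolding cox_length_def by (rule Least_le) auto

text \<open>The parity of the number of occurrences of \<open>t\<close> among the conjugates
  \<open>s\<^sub>1 \<dots> s\<^sub>i\<^sub>-\<^sub>1 s\<^sub>i (s\<^sub>1 \<dots> s\<^sub>i\<^sub>-\<^sub>1)\<inverse>\<close>; the recursion conjugates \<open>t\<close> instead of the list.\<close>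

fun odd_occ :: "'a list \<Rightarrow> 'a \<Rightarrow> bool" where
  "odd_occ [] t = False"
| "odd_occ (s # xs) t = ((t = s) \<noteq> odd_occ xs (inv s \<otimes> t \<otimes> s))"

text \<open>The cocycle identity: reading past \<open>xs\<close> conjugates \<open>t\<close> by the
  product of \<open>xs\<close>.\<close>

lemma odd_occ_append:
  assumes "xs \<in> lists (carrier W)" "t \<in> carrier W"
  shows "odd_occ (xs @ ys) t =
    (odd_occ xs t \<noteq> odd_occ ys (inv (word_prod W xs) \<otimes> t \<otimes> word_prod W xs))"
  using assms
proof (induction xs arbitrary: t)
  case (Cons x xs)
  then have "x \<in> carrier W" "word_prod W xs \<in> carrier W" by auto
  then show ?case using Cons by (simp add: inv_mult_group m_assoc) blast
qed simp

text \<open>Conjugation by \<open>s\<close> inverts the rotation \<open>s t\<close> of the dihedral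
  group generated by \<open>s\<close> and \<open>t\<close>.\<close>

lemma dihedral_pow:
  assumes st: "s \<in> S" "t \<in> S"
  shows "s \<otimes> inv ((s \<otimes> t) [^] (k::nat)) = (s \<otimes> t) [^] k \<otimes> s"
proof (induction k)
  case 0
  then show ?case using st generators_closed by auto
next
  case (Suc k)
  let ?c = "s \<otimes> t"
  have c: "s \<in> carrier W" "t \<in> carrier W" "?c [^] k \<in> carrier W"
    using st generators_closed by auto
  have "s \<otimes> inv (?c [^] Suc k) = s \<otimes> (inv ?c \<otimes> inv (?c [^] k))"
    using c by (simp add: inv_mult_group)
  also have "s \<otimes> (inv ?c \<otimes> inv (?c [^] k)) = ?c \<otimes> (s \<otimes> inv (?c [^] k))"
    using c st by (simp add: inv_mult_group generator_inv m_assoc)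
  also have "\<dots> = ?c \<otimes> ?c [^] k \<otimes> s"
    using c Suc by (simp add: m_assoc)
  also have "?c \<otimes> ?c [^] k = ?c [^] Suc k"
    using c by (intro nat_pow_Suc2[symmetric]) auto
  finally show ?case .
qed

text \<open>The conjugates attached to the alternating word of length \<open>2 * k\<close> are the
  dihedral reflections \<open>(s t)^j s\<close> for \<open>j < 2 * k\<close>; the sum counts how
  often \<open>r\<close> is among them.\<close>

lemma odd_occ_alternating:
  assumes st: "s \<in> S" "t \<in> S" and r: "r \<in> carrier W"
  shows "odd_occ (concat (replicate k [s, t])) r =
    odd (\<Sum>j<2 * k. of_bool (r = (s \<otimes> t) [^] j \<otimes> s) :: nat)"
proof (induction k)
  case (Suc k)
  let ?c = "s \<otimes> t" and ?xs = "concat (replicate k [s, t])"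
  define p where "p = ?c [^] k"
  have c: "s \<in> carrier W" "t \<in> carrier W" "?c \<in> carrier W" "p \<in> carrier W"
    using st generators_closed by (auto simp: p_def)
  have dp: "s \<otimes> inv p = p \<otimes> s"
    using dihedral_pow[OF st] by (simp add: p_def)
  have pp: "p \<otimes> p = ?c [^] (2 * k)"
    using c by (simp add: p_def nat_pow_mult mult_2)
  \<comment> \<open>The two letters appended to the word are conjugated by its product
    \<open>p\<close>. Moving \<open>inv p\<close> past \<open>s\<close> produces a second factor
    \<open>p\<close>, hence the exponents \<open>2 * k\<close> and \<open>2 * k + 1\<close>.\<close>
  have "p \<otimes> s \<otimes> inv p = ?c [^] (2 * k) \<otimes> s"
    using c by (simp add: m_assoc dp flip: pp)
  then have 1: "inv p \<otimes> r \<otimes> p = s \<longleftrightarrow> r = ?c [^] (2 * k) \<otimes> s"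
    using c r by (simp add: conj_eq_iff)
  have "inv s \<otimes> (inv p \<otimes> r \<otimes> p) \<otimes> s = t \<longleftrightarrow> inv p \<otimes> r \<otimes> p = s \<otimes> t \<otimes> s"
    using c r st conj_eq_iff[of s "inv p \<otimes> r \<otimes> p" t] by (simp add: generator_inv)
  also have "\<dots> \<longleftrightarrow> r = p \<otimes> (?c \<otimes> (s \<otimes> inv p))"
    using c r conj_eq_iff[of p r "s \<otimes> t \<otimes> s"] by (simp add: m_assoc)
  also have "p \<otimes> (?c \<otimes> (s \<otimes> inv p)) = p \<otimes> (?c \<otimes> p) \<otimes> s"
    using c by (simp add: m_assoc dp)
  also have "?c \<otimes> p = p \<otimes> ?c"
    using c by (metis nat_pow_Suc nat_pow_Suc2 p_def)
  also have "p \<otimes> (p \<otimes> ?c) = ?c [^] Suc (2 * k)"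
    using c by (simp flip: m_assoc pp)
  finally have 2: "inv s \<otimes> (inv p \<otimes> r \<otimes> p) \<otimes> s = t \<longleftrightarrow> r = ?c [^] Suc (2 * k) \<otimes> s" .
  have xs: "?xs \<in> lists (carrier W)"
    using c by (induction k) auto
  have "replicate (Suc k) [s, t] = replicate k [s, t] @ [[s, t]]"
    by (simp add: replicate_append_same)
  then have "concat (replicate (Suc k) [s, t]) = ?xs @ [s, t]"
    by (simp only: concat_append) simp
  then have "odd_occ (concat (replicate (Suc k) [s, t])) r =
      (odd_occ ?xs r \<noteq> odd_occ [s, t] (inv p \<otimes> r \<otimes> p))"
    using odd_occ_append[OF xs r] c by (simp add: word_prod_relator p_def)
  also have "odd_occ [s, t] (inv p \<otimes> r \<otimes> p) =
      ((r = ?c [^] (2 * k) \<otimes> s) \<noteq> (r = ?c [^] Suc (2 * k) \<otimes> s))"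
    by (simp only: odd_occ.simps 1 2) simp
  finally show ?case
    using Suc by (simp del: nat_pow_Suc)
qed simp

text \<open>Since \<open>(s t)^m = 1\<close>, the reflections \<open>(s t)^j s\<close> repeat with
  period \<open>m\<close>; the \<open>2 * m\<close> summands fall into two equal halves.\<close>

lemma odd_occ_relator:
  assumes m: "coxeter_presentation m" and st: "s \<in> S" "t \<in> S" and r: "r \<in> carrier W"
  shows "\<not> odd_occ (concat (replicate (m s t) [s, t])) r"
proof -
  let ?c = "s \<otimes> t" and ?m = "m s t"
  define g where "g j = (of_bool (r = ?c [^] j \<otimes> s) :: nat)" for j :: nat
  have c: "?c \<in> carrier W" using st generators_closed by auto
  have "?c [^] (?m + j) = ?c [^] j" for j
    using c relator_eq_one[OF m st] by (simp flip: nat_pow_mult)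
  then have "g (?m + j) = g j" for j
    by (simp add: g_def)
  moreover have "(\<Sum>j<a + b. g j) = (\<Sum>j<a. g j) + (\<Sum>j<b. g (a + j))" for a b
    by (induction b) (auto simp: add.assoc)
  ultimately have "even (\<Sum>j<2 * ?m. g j)" by (simp add: mult_2)
  then show ?thesis using odd_occ_alternating[OF st r] by (simp add: g_def)
qed

text \<open>A relator contributes an even count, and as its product is one it does not alter the
  conjugation seen by the letters after it.\<close>

lemma odd_occ_insert_relator:
  assumes m: "coxeter_presentation m" and ins: "insert_relator S m xs ys" and r: "r \<in> carrier W"
  shows "odd_occ xs r = odd_occ ys r"
proof -
  obtain us vs s t where uv: "us \<in> lists S" "vs \<in> lists S" and st: "s \<in> S" "t \<in> S"
    and xs: "xs = us @ vs" and ys: "ys = us @ concat (replicate (m s t) [s, t]) @ vs"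
    using ins unfolding insert_relator_def by blast
  let ?q = "concat (replicate (m s t) [s, t])"
  have us: "us \<in> lists (carrier W)" using uv lists_generators_closed by blast
  have c: "s \<in> carrier W" "t \<in> carrier W" using st generators_closed by auto
  have q: "?q \<in> lists (carrier W)" using c by (induction "m s t") auto
  define r' where "r' = inv (word_prod W us) \<otimes> r \<otimes> word_prod W us"
  have r': "r' \<in> carrier W" using us r by (simp add: r'_def)
  have "word_prod W ?q = \<one>"
    using relator_eq_one[OF m st] c by (simp add: word_prod_relator)
  then have "odd_occ (?q @ vs) r' = odd_occ vs r'"
    using odd_occ_append[OF q r', of vs] odd_occ_relator[OF m st r'] r' by simp
  then show ?thesis
    using odd_occ_append[OF us r] by (simp add: xs ys r'_def)
qed

text \<open>The parity depends only on the group element: by the presentation, words with equal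
  product are linked by insertions and removals of relators.\<close>

lemma odd_occ_cong:
  assumes xs: "xs \<in> lists S" and ys: "ys \<in> lists S"
    and eq: "word_prod W xs = word_prod W ys" and r: "r \<in> carrier W"
  shows "odd_occ xs r = odd_occ ys r"
proof -
  obtain m where m: "coxeter_presentation m" by (rule obtain_presentation)
  then have "equivclp (insert_relator S m) xs ys"
    using xs ys eq unfolding coxeter_presentation_def by blast
  then show ?thesis
  proof (induction rule: equivclp_induct)
    case (step y z)
    then show ?case using odd_occ_insert_relator[OF m _ r] by blast
  qed simp
qed

section \<open>Reflections and length\<close>

text \<open>Strong exchange: an odd count is nonzero, so \<open>t\<close> is some conjugate
  \<open>s1 ... si ... s1\<close>, and multiplying by it on the left deletes the letter
  \<open>si\<close>.\<close>

lemma odd_occ_deletion: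
  assumes "xs \<in> lists S" "t \<in> carrier W" "odd_occ xs t"
  shows "\<exists>ys\<in>lists S. length ys < length xs \<and> word_prod W ys = t \<otimes> word_prod W xs"
  using assms
proof (induction xs arbitrary: t)
  case (Cons s xs)
  then have s: "s \<in> S" "s \<in> carrier W" and xs: "xs \<in> lists S" "word_prod W xs \<in> carrier W"
    using generators_closed lists_generators_closed by auto
  show ?case
  proof (cases "t = s")
    case True
    have "t \<otimes> word_prod W (s # xs) = word_prod W xs"
      using True s xs generator_square by (simp flip: m_assoc)
    then show ?thesis using xs by (intro bexI[of _ xs]) auto
  next
    case False
    then have "odd_occ xs (inv s \<otimes> t \<otimes> s)" using Cons.prems by simp
    then obtain ys where ys: "ys \<in> lists S" "length ys < length xs"
      "word_prod W ys = inv s \<otimes> t \<otimes> s \<otimes> word_prod W xs"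
      using Cons.IH[of "inv s \<otimes> t \<otimes> s"] xs s Cons.prems by auto
    then have "word_prod W (s # ys) = t \<otimes> word_prod W (s # xs)"
      using s xs Cons.prems by (simp add: m_assoc mult_inv_cancel)
    then show ?thesis using ys s by (intro bexI[of _ "s # ys"]) auto
  qed
qed simp

text \<open>Replace \<open>xs\<close> by a reduced word of the same element, which keeps the parity,
  and delete a letter there.\<close>

lemma length_less_if_odd_occ:
  assumes "xs \<in> lists S" "t \<in> carrier W" "odd_occ xs t"
  shows "cox_length W S (t \<otimes> word_prod W xs) < cox_length W S (word_prod W xs)"
proof -
  have "word_prod W xs \<in> carrier W" using assms lists_generators_closed by auto
  then obtain zs where "reduced_word W S (word_prod W xs) zs" by (rule obtain_reduced_word)
  then have zs: "zs \<in> lists S" "word_prod W zs = word_prod W xs"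
    "length zs = cox_length W S (word_prod W xs)" by (auto simp: reduced_word_def)
  then have "odd_occ zs t" using odd_occ_cong assms by blast
  then obtain ys where "ys \<in> lists S" "length ys < length zs"
    "word_prod W ys = t \<otimes> word_prod W xs"
    using odd_occ_deletion[of zs t] zs assms by auto
  then show ?thesis using cox_length_le[of ys] zs by simp
qed

lemma reflection_closed: "t \<in> reflections W S \<Longrightarrow> t \<in> carrier W"
  using generators_closed by (auto simp: reflections_def)

lemma generator_reflection:
  assumes "s \<in> S"
  shows "s \<in> reflections W S"
proof -
  have "s = \<one> \<otimes> s \<otimes> inv \<one>" using assms generators_closed by auto
  then show ?thesis using assms unfolding reflections_def by blast
qed

lemma conj_reflection:
  assumes "g \<in> carrier W" "t \<in> reflections W S"
  shows "g \<otimes> t \<otimes> inv g \<in> reflections W S"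
proof -
  obtain w s where "t = w \<otimes> s \<otimes> inv w" "w \<in> carrier W" "s \<in> S"
    using assms by (auto simp: reflections_def)
  moreover from this have "g \<otimes> t \<otimes> inv g = (g \<otimes> w) \<otimes> s \<otimes> inv (g \<otimes> w)"
    using assms generators_closed by (simp add: inv_mult_group m_assoc subset_iff)
  ultimately show ?thesis using assms unfolding reflections_def by blast
qed

lemma reflection_square:
  assumes "t \<in> reflections W S"
  shows "t \<otimes> t = \<one>"
proof -
  obtain w s where t: "t = w \<otimes> s \<otimes> inv w" "w \<in> carrier W" "s \<in> S" "s \<in> carrier W"
    using assms generators_closed by (auto simp: reflections_def)
  have "t \<otimes> t = w \<otimes> (s \<otimes> s) \<otimes> inv w"
    using t by (simp add: m_assoc mult_inv_cancel)
  then show ?thesis using t generator_square by simp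
qed

text \<open>Spell \<open>t = w s inv w\<close> as \<open>ys\<close>, \<open>s\<close>,
  \<open>zs\<close>. The contributions of \<open>ys\<close> and \<open>zs\<close> cancel, and the
  middle letter contributes exactly one.\<close>

lemma odd_occ_reflection:
  assumes t: "t \<in> reflections W S" and xs: "xs \<in> lists S" "word_prod W xs = t"
  shows "odd_occ xs t"
proof -
  obtain w s where w: "t = w \<otimes> s \<otimes> inv w" "w \<in> carrier W" "s \<in> S" "s \<in> carrier W"
    using t generators_closed by (auto simp: reflections_def)
  obtain ys where ys: "ys \<in> lists S" "word_prod W ys = w" using w obtain_word by blast
  obtain zs where zs: "zs \<in> lists S" "word_prod W zs = inv w" using w obtain_word inv_closed by blast
  note c = ys(1)[THEN lists_generators_closed] zs(1)[THEN lists_generators_closed]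
  have tc: "t \<in> carrier W" using t by (rule reflection_closed)
  have conj: "inv w \<otimes> t \<otimes> w = s" using w tc by (simp add: conj_eq_iff)
  \<comment> \<open>Without the middle letter the word represents one, so it has the parity of the
    empty word.\<close>
  have "odd_occ (ys @ zs) t = odd_occ [] t"
    using ys zs c w tc by (intro odd_occ_cong) (auto simp: word_prod_append)
  then have 1: "odd_occ ys t = odd_occ zs s"
    using odd_occ_append[OF c(1) tc] ys conj by simp
  have "word_prod W (ys @ s # zs) = t"
    using ys zs c w by (simp add: word_prod_append m_assoc)
  then have "odd_occ xs t = odd_occ (ys @ s # zs) t"
    using ys zs xs w tc by (intro odd_occ_cong) auto
  also have "\<dots> = (odd_occ ys t \<noteq> odd_occ (s # zs) s)"
    using odd_occ_append[OF c(1) tc] ys conj by simp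
  also have "odd_occ (s # zs) s = (\<not> odd_occ zs s)"
    using w by simp
  finally show ?thesis using 1 by simp
qed

text \<open>If the parity at \<open>w\<close> is even, the cocycle identity makes it odd at
  \<open>t w\<close>; then \<open>t (t w) = w\<close> is shorter than \<open>t w\<close>. The two
  cases exclude each other, which gives both equivalences.\<close>

lemma odd_occ_iff_length_less:
  assumes t: "t \<in> reflections W S" and xs: "xs \<in> lists S"
  shows "odd_occ xs t \<longleftrightarrow> cox_length W S (t \<otimes> word_prod W xs) < cox_length W S (word_prod W xs)"
    and "\<not> odd_occ xs t \<longleftrightarrow> cox_length W S (word_prod W xs) < cox_length W S (t \<otimes> word_prod W xs)"
proof -
  have tc: "t \<in> carrier W" using t by (rule reflection_closed)
  have xc: "word_prod W xs \<in> carrier W" using xs lists_generators_closed by auto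
  have 1: "cox_length W S (t \<otimes> word_prod W xs) < cox_length W S (word_prod W xs)"
    if "odd_occ xs t" using length_less_if_odd_occ[OF xs tc that] .
  have 2: "cox_length W S (word_prod W xs) < cox_length W S (t \<otimes> word_prod W xs)"
    if "\<not> odd_occ xs t"
  proof -
    obtain ts where ts: "ts \<in> lists S" "word_prod W ts = t" using tc obtain_word by blast
    have tl: "ts \<in> lists (carrier W)" using ts lists_generators_closed by blast
    have "odd_occ (ts @ xs) t = (odd_occ ts t \<noteq> odd_occ xs t)"
      using odd_occ_append[OF tl tc] ts tc by (simp add: m_assoc)
    then have "odd_occ (ts @ xs) t" using that odd_occ_reflection[OF t ts] by simp
    then have "cox_length W S (t \<otimes> word_prod W (ts @ xs)) < cox_length W S (word_prod W (ts @ xs))"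
      using ts xs tc by (intro length_less_if_odd_occ) auto
    moreover have "word_prod W (ts @ xs) = t \<otimes> word_prod W xs"
      using ts tl xs lists_generators_closed by (simp add: word_prod_append)
    moreover have "t \<otimes> (t \<otimes> word_prod W xs) = word_prod W xs"
      using tc xc reflection_square[OF t] by (simp flip: m_assoc)
    ultimately show ?thesis by simp
  qed
  show "odd_occ xs t \<longleftrightarrow> cox_length W S (t \<otimes> word_prod W xs) < cox_length W S (word_prod W xs)"
    "\<not> odd_occ xs t \<longleftrightarrow> cox_length W S (word_prod W xs) < cox_length W S (t \<otimes> word_prod W xs)"
    using 1 2 less_asym by blast+
qed

lemma length_reflection_neq:
  assumes "t \<in> reflections W S" "w \<in> carrier W"
  shows "cox_length W S (t \<otimes> w) \<noteq> cox_length W S w"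
proof -
  obtain xs where "xs \<in> lists S" "word_prod W xs = w" using assms(2) obtain_word by blast
  then show ?thesis using odd_occ_iff_length_less[OF assms(1)] by (metis less_irrefl)
qed

text \<open>For \<open>r = s t inv s\<close>, which differs from \<open>s\<close> because
  \<open>t\<close> does, prepending \<open>s\<close> turns the parity of \<open>xs\<close> at
  \<open>t\<close> into that of \<open>s # xs\<close> at \<open>r\<close>. Moreover
  \<open>r (s u) = s (t u)\<close>.\<close>

lemma length_less_generator_mult:
  assumes t: "t \<in> reflections W S" and s: "s \<in> S" and neq: "t \<noteq> s" and u: "u \<in> carrier W"
    and less: "cox_length W S u < cox_length W S (t \<otimes> u)"
  shows "cox_length W S (s \<otimes> u) < cox_length W S (s \<otimes> (t \<otimes> u))"
proof -
  obtain xs where xs: "xs \<in> lists S" "word_prod W xs = u" using u obtain_word by blast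
  have sc: "s \<in> carrier W" and tc: "t \<in> carrier W"
    using s generators_closed reflection_closed[OF t] by auto
  define r where "r = s \<otimes> t \<otimes> inv s"
  have r: "r \<in> reflections W S" using conj_reflection[OF sc t] by (simp add: r_def)
  have conj: "inv s \<otimes> r \<otimes> s = t"
    using sc tc by (simp add: conj_eq_iff r_def)
  have "r \<noteq> s" using neq conj sc by auto
  moreover have "\<not> odd_occ xs t" using odd_occ_iff_length_less(2)[OF t] xs less by simp
  ultimately have "\<not> odd_occ (s # xs) r" using conj by simp
  then have "cox_length W S (s \<otimes> u) < cox_length W S (r \<otimes> (s \<otimes> u))"
    using odd_occ_iff_length_less(2)[OF r, of "s # xs"] xs s by simp
  moreover have "r \<otimes> (s \<otimes> u) = s \<otimes> (t \<otimes> u)"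
    using sc tc u by (simp add: r_def m_assoc mult_inv_cancel)
  ultimately show ?thesis by simp
qed

section \<open>The Bruhat order\<close>

abbreviation bruhat_le :: "'a \<Rightarrow> 'a \<Rightarrow> bool"  (infix "\<preceq>" 50) where
  "x \<preceq> y \<equiv> (bruhat_step W S)\<^sup>*\<^sup>* x y"

lemma bruhat_simps [simp]:
  "carrier (bruhat W S) = carrier W" "(x \<sqsubseteq>\<^bsub>bruhat W S\<^esub> y) = (x \<preceq> y)"
  "(x .=\<^bsub>bruhat W S\<^esub> y) = (x = y)"
  by (simp_all add: bruhat_def)

lemma bruhat_step_closed: "bruhat_step W S u v \<Longrightarrow> u \<in> carrier W \<and> v \<in> carrier W"
  using reflection_closed by (auto simp: bruhat_step_def)

text \<open>Reflections are closed under conjugation, so the right multiplication in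
  \<open>bruhat_step\<close> can be traded for the left multiplication that suits left
  descents.\<close>

lemma bruhat_stepI:
  assumes "u \<in> carrier W" "t \<in> reflections W S" "cox_length W S u < cox_length W S (t \<otimes> u)"
  shows "bruhat_step W S u (t \<otimes> u)"
proof -
  have tc: "t \<in> carrier W" using assms reflection_closed by blast
  have "inv u \<otimes> t \<otimes> inv (inv u) \<in> reflections W S"
    using assms by (intro conj_reflection) auto
  moreover have "u \<otimes> (inv u \<otimes> t \<otimes> inv (inv u)) = t \<otimes> u"
    using assms tc by (simp add: m_assoc mult_inv_cancel)
  ultimately show ?thesis using assms unfolding bruhat_step_def by metis
qed

lemma bruhat_stepE:
  assumes "bruhat_step W S u v"
  obtains t where "u \<in> carrier W" "t \<in> reflections W S" "v = t \<otimes> u"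
    "cox_length W S u < cox_length W S v"
proof -
  obtain t where t: "u \<in> carrier W" "t \<in> reflections W S" "v = u \<otimes> t"
    "cox_length W S u < cox_length W S v"
    using assms by (auto simp: bruhat_step_def)
  have "u \<otimes> t \<otimes> inv u \<otimes> u = v"
    using t reflection_closed[of t] by (simp add: m_assoc)
  then show thesis using that[of "u \<otimes> t \<otimes> inv u"] t conj_reflection by auto
qed

lemma bruhat_le_length: "x \<preceq> y \<Longrightarrow> x = y \<or> cox_length W S x < cox_length W S y"
  by (induction rule: rtranclp_induct) (auto simp: bruhat_step_def)

lemma partial_order_bruhat: "partial_order (bruhat W S)"
proof unfold_locales
  fix x y
  assume "x \<sqsubseteq>\<^bsub>bruhat W S\<^esub> y" "y \<sqsubseteq>\<^bsub>bruhat W S\<^esub> x"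
  then show "x .=\<^bsub>bruhat W S\<^esub> y"
    using bruhat_le_length[of x y] bruhat_le_length[of y x] by auto
qed (auto simp: bruhat_def)

section \<open>The operators taking the smaller and the larger of \<open>w\<close> and
  \<open>s w\<close>\<close>

definition tau_gen :: "'a \<Rightarrow> 'a \<Rightarrow> 'a" where
  "tau_gen s w = (if s \<in> Des W S w then w else s \<otimes> w)"

lemma generator_cancel: "s \<in> S \<Longrightarrow> w \<in> carrier W \<Longrightarrow> s \<otimes> (s \<otimes> w) = w"
  using generator_square generators_closed by (metis l_one m_assoc subsetD)

lemma generator_mult_closed: "s \<in> S \<Longrightarrow> w \<in> carrier W \<Longrightarrow> s \<otimes> w \<in> carrier W"
  using generators_closed by auto

lemma pi_gen_closed: "s \<in> S \<Longrightarrow> w \<in> carrier W \<Longrightarrow> pi_gen W S s w \<in> carrier W"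
  by (simp add: pi_gen_def generator_mult_closed)

lemma tau_gen_closed: "s \<in> S \<Longrightarrow> w \<in> carrier W \<Longrightarrow> tau_gen s w \<in> carrier W"
  by (simp add: tau_gen_def generator_mult_closed)

lemma Des_generator_mult:
  assumes "s \<in> S" "w \<in> carrier W"
  shows "s \<in> Des W S (s \<otimes> w) \<longleftrightarrow> s \<notin> Des W S w"
  using assms length_reflection_neq[OF generator_reflection, of s w]
  by (auto simp: Des_def generator_cancel)

lemma bruhat_step_generator:
  assumes "s \<in> S" "w \<in> carrier W" "s \<notin> Des W S w"
  shows "bruhat_step W S w (s \<otimes> w)"
  using assms length_reflection_neq[OF generator_reflection, of s w]
  by (intro bruhat_stepI) (auto simp: Des_def generator_reflection)

lemma pi_gen_le:
  assumes "s \<in> S" "w \<in> carrier W"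
  shows "pi_gen W S s w \<preceq> w" "pi_gen W S s w \<preceq> s \<otimes> w"
  using assms bruhat_step_generator[of s w] bruhat_step_generator[of s "s \<otimes> w"]
  by (auto simp: pi_gen_def Des_generator_mult generator_cancel generator_mult_closed)

lemma le_tau_gen:
  assumes "s \<in> S" "w \<in> carrier W"
  shows "w \<preceq> tau_gen s w" "s \<otimes> w \<preceq> tau_gen s w"
  using assms bruhat_step_generator[of s w] bruhat_step_generator[of s "s \<otimes> w"]
  by (auto simp: tau_gen_def Des_generator_mult generator_cancel generator_mult_closed)

lemma pi_gen_tau_gen: "s \<in> S \<Longrightarrow> w \<in> carrier W \<Longrightarrow> pi_gen W S s (tau_gen s w) = pi_gen W S s w"
  by (simp add: pi_gen_def tau_gen_def Des_generator_mult generator_cancel)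

lemma tau_gen_pi_gen: "s \<in> S \<Longrightarrow> w \<in> carrier W \<Longrightarrow> tau_gen s (pi_gen W S s w) = tau_gen s w"
  by (simp add: pi_gen_def tau_gen_def Des_generator_mult generator_cancel)

lemma pi_tau_gen_generator_mult:
  assumes "s \<in> S" "w \<in> carrier W"
  shows "pi_gen W S s (s \<otimes> w) = pi_gen W S s w" "tau_gen s (s \<otimes> w) = tau_gen s w"
  using assms by (auto simp: pi_gen_def tau_gen_def Des_generator_mult generator_cancel)

text \<open>Left multiplication by \<open>s\<close> conjugates the reflection \<open>t\<close> of
  the step to \<open>s t inv s\<close>; the length still increases unless \<open>t = s\<close>,
  which is the exceptional case \<open>v = s u\<close>.\<close>

lemma bruhat_step_generator_mult:
  assumes s: "s \<in> S" and step: "bruhat_step W S u v"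
  shows "v = s \<otimes> u \<or> bruhat_step W S (s \<otimes> u) (s \<otimes> v)"
proof -
  obtain t where t: "u \<in> carrier W" "t \<in> reflections W S" "v = t \<otimes> u"
    "cox_length W S u < cox_length W S v" using step by (rule bruhat_stepE)
  have sc: "s \<in> carrier W" and tc: "t \<in> carrier W"
    using s generators_closed reflection_closed t by auto
  show ?thesis
  proof (cases "t = s")
    case False
    have "s \<otimes> v = (s \<otimes> t \<otimes> inv s) \<otimes> (s \<otimes> u)"
      using sc tc t by (simp add: m_assoc mult_inv_cancel)
    moreover have "cox_length W S (s \<otimes> u) < cox_length W S (s \<otimes> v)"
      using length_less_generator_mult[of t s u] False s t by simp
    ultimately show ?thesis
      using bruhat_stepI[of "s \<otimes> u" "s \<otimes> t \<otimes> inv s"] sc t conj_reflection by simp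
  qed (use t in simp)
qed

text \<open>If \<open>v = s u\<close>, both sides agree. Otherwise \<open>u\<close> to
  \<open>v\<close> and \<open>s u\<close> to \<open>s v\<close> are both steps; the left side is
  below \<open>u\<close> and \<open>s u\<close>, and the right side is \<open>v\<close> or
  \<open>s v\<close>.\<close>

lemma pi_gen_step_mono:
  assumes s: "s \<in> S" and step: "bruhat_step W S u v"
  shows "pi_gen W S s u \<preceq> pi_gen W S s v"
proof (cases "v = s \<otimes> u")
  case True
  then show ?thesis using pi_tau_gen_generator_mult s bruhat_step_closed[OF step] by simp
next
  case False
  then have "bruhat_step W S (s \<otimes> u) (s \<otimes> v)" using bruhat_step_generator_mult[OF s step] by simp
  moreover have "pi_gen W S s u \<preceq> u" "pi_gen W S s u \<preceq> s \<otimes> u"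
    using pi_gen_le s bruhat_step_closed[OF step] by auto
  moreover have "pi_gen W S s v \<in> {v, s \<otimes> v}" by (simp add: pi_gen_def)
  ultimately show ?thesis using step by (auto intro: rtranclp.rtrancl_into_rtrancl)
qed

lemma tau_gen_step_mono:
  assumes s: "s \<in> S" and step: "bruhat_step W S u v"
  shows "tau_gen s u \<preceq> tau_gen s v"
proof (cases "v = s \<otimes> u")
  case True
  then show ?thesis using pi_tau_gen_generator_mult s bruhat_step_closed[OF step] by simp
next
  case False
  then have "bruhat_step W S (s \<otimes> u) (s \<otimes> v)" using bruhat_step_generator_mult[OF s step] by simp
  moreover have "v \<preceq> tau_gen s v" "s \<otimes> v \<preceq> tau_gen s v"
    using le_tau_gen s bruhat_step_closed[OF step] by auto
  moreover have "tau_gen s u \<in> {u, s \<otimes> u}" by (simp add: tau_gen_def)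
  ultimately show ?thesis using step by (auto intro: converse_rtranclp_into_rtranclp)
qed

lemma pi_gen_mono: "x \<preceq> y \<Longrightarrow> s \<in> S \<Longrightarrow> pi_gen W S s x \<preceq> pi_gen W S s y"
  by (induction rule: rtranclp_induct) (auto dest: pi_gen_step_mono intro: rtranclp_trans)

lemma tau_gen_mono: "x \<preceq> y \<Longrightarrow> s \<in> S \<Longrightarrow> tau_gen s x \<preceq> tau_gen s y"
  by (induction rule: rtranclp_induct) (auto dest: tau_gen_step_mono intro: rtranclp_trans)

text \<open>Apply the monotone map \<open>tau_gen s\<close>, respectively
  \<open>pi_gen W S s\<close>. Both are constant on the pair of \<open>w\<close> and
  \<open>s w\<close>, so each absorbs the other.\<close>

lemma pi_gen_tau_gen_adjoint:
  assumes "s \<in> S" "x \<in> carrier W" "y \<in> carrier W"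
  shows "pi_gen W S s x \<preceq> y \<longleftrightarrow> x \<preceq> tau_gen s y"
proof
  assume "pi_gen W S s x \<preceq> y"
  then have "tau_gen s x \<preceq> tau_gen s y"
    using tau_gen_mono[of "pi_gen W S s x" y s] assms by (simp add: tau_gen_pi_gen)
  then show "x \<preceq> tau_gen s y" using le_tau_gen(1)[of s x] assms by (auto intro: rtranclp_trans)
next
  assume "x \<preceq> tau_gen s y"
  then have "pi_gen W S s x \<preceq> pi_gen W S s y"
    using pi_gen_mono[of x "tau_gen s y" s] assms by (simp add: pi_gen_tau_gen)
  then show "pi_gen W S s x \<preceq> y" using pi_gen_le(1)[of s y] assms by (auto intro: rtranclp_trans)
qed

section \<open>Composition along a word\<close>

lemma foldr_pi_gen_closed:
  "ss \<in> lists S \<Longrightarrow> w \<in> carrier W \<Longrightarrow> foldr (pi_gen W S) ss w \<in> carrier W"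
  by (induction ss) (auto simp: pi_gen_closed)

lemma foldr_pi_gen_mono:
  "ss \<in> lists S \<Longrightarrow> x \<preceq> y \<Longrightarrow> foldr (pi_gen W S) ss x \<preceq> foldr (pi_gen W S) ss y"
  by (induction ss) (auto simp: pi_gen_mono)

text \<open>Closing upwards between two operators does not change the final upper closure, so each
  new operator can be applied to a member of the completion.\<close>

lemma nabla_foldr_pi_gen_in_Mac:
  assumes F: "F \<in> Mac (bruhat W S)" and ss: "ss \<in> lists S"
  shows "nabla (bruhat W S) (foldr (pi_gen W S) ss ` F) \<in> Mac (bruhat W S)"
  using ss
proof (induction rule: lists.induct)
  case Nil
  have "nabla (bruhat W S) F = F"
  proof (intro equalityI subsetI)
    fix w assume "w \<in> F"
    then show "w \<in> nabla (bruhat W S) F"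
      using F by (auto simp: nabla_def Mac_def order_filter_def)
  qed (use F in \<open>auto simp: nabla_def Mac_def order_filter_def\<close>)
  then show ?case using F by simp
next
  case (Cons s ss)
  interpret B: partial_order "bruhat W S" by (rule partial_order_bruhat)
  note s = Cons.hyps(1) and ss = Cons.hyps(2)
  let ?G = "foldr (pi_gen W S) ss ` F"
  have pi_closed: "pi_gen W S s \<in> carrier (bruhat W S) \<rightarrow> carrier (bruhat W S)"
    using pi_gen_closed[OF s] by simp
  have "F \<subseteq> carrier W" using F by (simp add: Mac_def order_filter_def)
  then have "?G \<subseteq> carrier (bruhat W S)" using foldr_pi_gen_closed[OF ss] by auto
  then have "nabla (bruhat W S) (pi_gen W S s ` nabla (bruhat W S) ?G) =
      nabla (bruhat W S) (pi_gen W S s ` ?G)"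
    by (intro B.nabla_image_nabla[OF pi_closed]) (simp_all add: pi_gen_mono s)
  moreover have "nabla (bruhat W S) (pi_gen W S s ` nabla (bruhat W S) ?G) \<in> Mac (bruhat W S)"
  proof (rule B.nabla_lower_adjoint_in_Mac[OF pi_closed])
    show "tau_gen s \<in> carrier (bruhat W S) \<rightarrow> carrier (bruhat W S)"
      using tau_gen_closed[OF s] by simp
  qed (use s ss Cons.IH in \<open>simp_all add: pi_gen_tau_gen_adjoint\<close>)
  ultimately show ?case by (simp add: image_image)
qed

end

theorem theorem1p1:
  fixes W :: "('a, 'b) monoid_scheme" and S :: "'a set"
  assumes "coxeter_system W S"
    and "F \<in> Mac (bruhat W S)"
    and "u \<in> carrier W"
  shows "nabla (bruhat W S) (pi_elt W S u ` F) \<in> Mac (bruhat W S) \<and>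
    (\<forall>Y. Y \<subseteq> carrier W \<longrightarrow>
       nabla (bruhat W S) (pi_elt W S u ` nabla (bruhat W S) Y) =
       nabla (bruhat W S) (pi_elt W S u ` Y))"
proof -
  interpret coxeter_system W S by fact
  interpret B: partial_order "bruhat W S" by (rule partial_order_bruhat)
  \<comment> \<open>A reduced word of \<open>u\<close> exists, so the choice in
    \<open>pi_elt\<close> yields a word over \<open>S\<close>.\<close>
  have "reduced_word W S u (SOME ss. reduced_word W S u ss)"
    using obtain_reduced_word[OF assms(3)] by (metis someI)
  then obtain ss where ss: "ss \<in> lists S" and pi: "pi_elt W S u = foldr (pi_gen W S) ss"
    by (auto simp: pi_elt_def reduced_word_def)
  show ?thesis
    unfolding pi
  proof (intro conjI allI impI)
    show "nabla (bruhat W S) (foldr (pi_gen W S) ss ` F) \<in> Mac (bruhat W S)"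
      using assms(2) ss by (rule nabla_foldr_pi_gen_in_Mac)
  next
    fix Y assume "Y \<subseteq> carrier W"
    then show "nabla (bruhat W S) (foldr (pi_gen W S) ss ` nabla (bruhat W S) Y) =
        nabla (bruhat W S) (foldr (pi_gen W S) ss ` Y)"
      using foldr_pi_gen_closed[OF ss] foldr_pi_gen_mono[OF ss]
      by (intro B.nabla_image_nabla) simp_all
  qed
qed

end
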